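(* The function $f:(0,\infty)\to(0,\infty)$ defined by $f(x)=\frac{1}{\arctan x}$ is not a Stieltjes transform on $(0,\infty)$.
   Context: A function $f:(0,\infty)\to\mathbb{R}$ is called a Stieltjes transform if there exist a real number $a\ge 0$ and a non-negative Borel measure $\mu$ on $[0,\infty)$ satisfying $\int_0^{\infty}\frac{d\mu(t)}{1+t}<\infty$ such that $f(x)=a+\int_0^{\infty}\frac{d\mu(t)}{x+t}$ for all $x>0$, where the integrals are over $[0,\infty)$. Here $\arctan$ is the usual real arctangent with values in $(-\pi/2,\pi/2)$. *)

theory Defs
  imports "HOL-Analysis.Analysis"
begin

(* A function on (0,\<infinity>) is represented by a total function on the reals of which only the
   values at x > 0 are used. The measure has carrier [0,\<infinity>) and may have an atom at 0.
   Finiteness of the extended nonnegative integral makes t \<mapsto> 1 / (x + t) integrable for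
   every x > 0, so the Bochner integral below never takes its default value. *)
definition stieltjes_transform :: "(real \<Rightarrow> real) \<Rightarrow> bool" where
  "stieltjes_transform f \<longleftrightarrow>
     (\<exists>(a::real) (\<mu>::real measure).
        a \<ge> 0 \<and>
        sets \<mu> = sets (restrict_space borel {0..}) \<and>
        (\<integral>\<^sup>+ t. ennreal (1 / (1 + t)) \<partial>\<mu>) < \<infinity> \<and>
        (\<forall>x>0. f x = a + (\<integral> t. 1 / (x + t) \<partial>\<mu>)))"

end

theory Submission
  imports Defs
begin

text \<open>
  If \<open>f\<close> is a Stieltjes transform, then \<open>x f(x) = a x + \<integral> x / (x + t) d\<mu>(t)\<close> is concave,
  because every integrand is. But \<open>x / arctan x\<close> is not concave: it lies strictly below
  its chord over \<open>[1 / \<surd>3, \<surd>3]\<close> at \<open>x = 1\<close>, where all three vals are explicit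
  algebraic multiples of \<open>1 / \<pi>\<close>.
\<close>

text \<open>Writing \<open>w / (w + t) = 1 - t / (w + t)\<close> with \<open>t\<close> nonnegative
  reduces the claim to the convexity of \<open>inverse\<close> on the positive half-line; the
  weights sum to 1, so the constant 1 and the shift by \<open>t\<close> both survive
  averaging.\<close>

lemma Stieltjes_kernel_concave:
  fixes t u v x y :: real
  assumes "t \<ge> 0" "x > 0" "y > 0" "u \<ge> 0" "v \<ge> 0" "u + v = 1"
  shows "u * x / (x + t) + v * y / (y + t) \<le> (u * x + v * y) / (u * x + v * y + t)"
proof -
  define z where "z = u * x + v * y"
  have z: "z + t = u * (x + t) + v * (y + t)"
  proof -
    have "u * (x + t) + v * (y + t) = z + (u + v) * t"
      by (simp add: z_def algebra_simps)
    then show ?thesis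
      using assms(6) by simp
  qed
  have "z > 0"
    \<comment> \<open>Applied to \<open>-x\<close> and \<open>-y\<close>, both below 0: their convex
      combination \<open>-z\<close> stays below 0.\<close>
    unfolding z_def using convex_bound_lt[of "-x" 0 "-y" u v] assms by simp
  have *: "w / (w + t) = 1 - t * inverse (w + t)" if "w > 0" for w
    using that assms(1) by (simp add: field_simps)
  have "inverse (z + t) \<le> u * inverse (x + t) + v * inverse (y + t)"
    using convex_on_inverse[of "{0<..}"] assms unfolding z convex_on_def by simp
  from mult_left_mono[OF this assms(1)]
  have "u * (1 - t * inverse (x + t)) + v * (1 - t * inverse (y + t)) \<le> 1 - t * inverse (z + t)"
    using assms(6) by (simp add: right_diff_distrib distrib_left mult.left_commute)
  then have "u * (x / (x + t)) + v * (y / (y + t)) \<le> z / (z + t)"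
    using * assms(2,3) \<open>z > 0\<close> by simp
  then show ?thesis
    by (simp add: z_def)
qed

text \<open>The finiteness condition is the case \<open>x = 1\<close>. It dominates every other
  positive \<open>x\<close>, since \<open>1 + t\<close> is at most
  \<open>max 1 (1 / x) * (x + t)\<close> for nonnegative \<open>t\<close>.\<close>

lemma Stieltjes_kernel_integrable:
  fixes \<mu> :: "real measure"
  assumes sets: "sets \<mu> = sets (restrict_space borel {0..})"
    and fin: "(\<integral>\<^sup>+ t. ennreal (1 / (1 + t)) \<partial>\<mu>) < \<infinity>" and "x > 0"
  shows "integrable \<mu> (\<lambda>t. 1 / (x + t))"
proof -
  have space: "space \<mu> = {0..}"
    using sets_eq_imp_space_eq[OF sets] by (simp add: space_restrict_space)
  \<comment> \<open>The kernel is Borel on the whole line, pole included, where division by zero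
    gives 0; measurability then passes to the restriction.\<close>
  have meas: "(\<lambda>t. 1 / (y + t)) \<in> borel_measurable \<mu>" for y :: real
    unfolding measurable_cong_sets[OF sets refl]
    by (intro measurable_restrict_space1) measurable
  have "integrable \<mu> (\<lambda>t. 1 / (1 + t))"
    by (rule integrableI_nonneg[OF meas _ fin]) (auto intro!: AE_I2 simp: space)
  then have "integrable \<mu> (\<lambda>t. max 1 (1 / x) * (1 / (1 + t)))"
    by (rule integrable_mult_right)
  then show ?thesis
  proof (rule Bochner_Integration.integrable_bound[OF _ meas])
    have "1 / (x + t) \<le> max 1 (1 / x) * (1 / (1 + t))" if "t \<ge> 0" for t
    proof -
      have "1 * t \<le> max 1 (1 / x) * t"
        using that by (intro mult_right_mono) auto
      moreover have "1 / x * x \<le> max 1 (1 / x) * x"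
        using \<open>x > 0\<close> by (intro mult_right_mono) auto
      ultimately have "1 + t \<le> max 1 (1 / x) * (x + t)"
        using \<open>x > 0\<close> by (simp add: algebra_simps)
      then show ?thesis
        using that \<open>x > 0\<close> by (simp add: field_simps)
    qed
    then show "AE t in \<mu>. norm (1 / (x + t)) \<le> norm (max 1 (1 / x) * (1 / (1 + t)))"
      using \<open>x > 0\<close> by (auto intro!: AE_I2 simp: space abs_mult)
  qed
qed

lemma stieltjes_transform_concave:
  assumes "stieltjes_transform f"
  shows "concave_on {0<..} (\<lambda>x. x * f x)"
  unfolding concave_on_iff
proof (intro conjI ballI allI impI)
  obtain a \<mu> where
    sets: "sets \<mu> = sets (restrict_space borel {0..})"
    and fin: "(\<integral>\<^sup>+ t. ennreal (1 / (1 + t)) \<partial>\<mu>) < \<infinity>"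
    and f: "\<And>x. x > 0 \<Longrightarrow> f x = a + (\<integral> t. 1 / (x + t) \<partial>\<mu>)"
    using assms unfolding stieltjes_transform_def by blast
  have space: "space \<mu> = {0..}"
    using sets_eq_imp_space_eq[OF sets] by (simp add: space_restrict_space)
  have int: "integrable \<mu> (\<lambda>t. c * (1 / (w + t)))" if "w > 0" for c w
    using Stieltjes_kernel_integrable[OF sets fin that] by (rule integrable_mult_right)
  show "convex {0::real<..}"
    by simp
  fix x y u v :: real
  assume "x \<in> {0<..}" "y \<in> {0<..}" and uv: "u \<ge> 0" "v \<ge> 0" "u + v = 1"
  then have xy: "x > 0" "y > 0" by auto
  define z where "z = u * x + v * y"
  have "z > 0"
    unfolding z_def using convex_bound_lt[of "-x" 0 "-y" u v] xy uv by simp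
  have "u * x * (\<integral> t. 1 / (x + t) \<partial>\<mu>) + v * y * (\<integral> t. 1 / (y + t) \<partial>\<mu>)
      = (\<integral> t. u * x * (1 / (x + t)) + v * y * (1 / (y + t)) \<partial>\<mu>)"
    by (simp only: Bochner_Integration.integral_add[OF int[OF xy(1)] int[OF xy(2)]]
        integral_mult_right_zero)
  also have "\<dots> \<le> (\<integral> t. z * (1 / (z + t)) \<partial>\<mu>)"
    using Stieltjes_kernel_concave[OF _ xy uv, folded z_def]
    by (intro integral_mono Bochner_Integration.integrable_add int xy \<open>z > 0\<close>)
      (auto simp: space)
  also have "\<dots> = z * (\<integral> t. 1 / (z + t) \<partial>\<mu>)"
    by (rule integral_mult_right_zero)
  \<comment> \<open>The term \<open>a * x\<close> is linear in \<open>x\<close>, so it contributes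
    \<open>a * z\<close> to both sides.\<close>
  finally have "u * (x * f x) + v * (y * f y) \<le> z * f z"
    unfolding f[OF xy(1)] f[OF xy(2)] f[OF \<open>z > 0\<close>] by (simp add: z_def algebra_simps)
  then show "u * (x * f x) + v * (y * f y) \<le> (u *\<^sub>R x + v *\<^sub>R y) * f (u *\<^sub>R x + v *\<^sub>R y)"
    by (simp add: z_def)
qed

theorem theorem2p2:
  shows "\<not> stieltjes_transform (\<lambda>x::real. 1 / arctan x)"
proof
  assume "stieltjes_transform (\<lambda>x::real. 1 / arctan x)"
  then have concave: "concave_on {0<..} (\<lambda>x. x * (1 / arctan x))"
    by (rule stieltjes_transform_concave)
  define r where "r = sqrt (3::real)"
  have r: "r > 0" "r * r = 3"
    by (auto simp: r_def)
  have "1 < r" "r < 3"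
    by (auto simp: r_def real_less_lsqrt)
  \<comment> \<open>These weights solve \<open>u + v = 1\<close> and
    \<open>u / r + v * r = 1\<close>, placing the point 1 between \<open>1 / r\<close> and
    \<open>r\<close>.\<close>
  define u where "u = (3 - r) / 2"
  define v where "v = (r - 1) / 2"
  have uv: "u \<ge> 0" "v \<ge> 0" "u + v = 1"
    using \<open>1 < r\<close> \<open>r < 3\<close> by (auto simp: u_def v_def field_simps)
  have inv: "1 / r = r / 3"
    using r by (simp add: field_simps)
  have mid: "u * (1 / r) + v * r = 1"
    unfolding inv u_def v_def using r by (simp add: field_simps)
  have vals: "arctan (1 / r) = pi / 6" "arctan r = pi / 3"
    using arctan_unique[of "pi / 6" "1 / r"] arctan_unique[of "pi / 3" r]
    by (simp_all add: r_def tan_30 tan_60)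
  have "1 / r \<in> {0<..}" "r \<in> {0<..}"
    using r(1) by auto
  with concave uv have "u * (1 / r * (1 / arctan (1 / r))) + v * (r * (1 / arctan r))
      \<le> (u *\<^sub>R (1 / r) + v *\<^sub>R r) * (1 / arctan (u *\<^sub>R (1 / r) + v *\<^sub>R r))"
    unfolding concave_on_iff by blast
  then have "u * (1 / r * (1 / arctan (1 / r))) + v * (r * (1 / arctan r)) \<le> 1 * (1 / arctan 1)"
    unfolding real_scaleR_def mid .
  \<comment> \<open>The reciprocal arctangents are \<open>6 / pi\<close>, \<open>3 / pi\<close> and
    \<open>4 / pi\<close>. Clearing denominators amounts to multiplying by the square of
    \<open>pi\<close>, which leaves one positive factor to cancel.\<close>
  then have "pi * (u * (r / 3 * 6) + v * (r * 3)) \<le> pi * 4"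
    unfolding vals arctan_one unfolding inv by (simp add: field_simps)
  then have "u * (r / 3 * 6) + v * (r * 3) \<le> 4"
    by (simp only: mult_le_cancel_left_pos[OF pi_gt_zero])
  \<comment> \<open>With \<open>r * r = 3\<close> the left side equals
    \<open>(3 * r + 3) / 2\<close>.\<close>
  then have "3 * r \<le> 5"
    using r(2) by (simp add: u_def v_def field_simps)
  \<comment> \<open>Squaring yields 27 on the left and 25 on the right.\<close>
  then have "(3 * r) * (3 * r) \<le> 5 * 5"
    using r(1) by (intro mult_mono) auto
  then show False
    using r(2) by (simp add: algebra_simps)
qed

end
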